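(* Let $\mathcal{P}$ be a parabola with focus $F$ and axis of symmetry $a$, and let $\mathcal{D}$ be a circle centered at $F$. Let $ABCD$ be a (nondegenerate) quadrilateral inscribed in $\mathcal{D}$ and circumscribed about $\mathcal{P}$, and denote by $G\in AD\cap BC$ and $H\in AB\cap CD$ the points of intersection of the pairs of lines containing opposite sides. Then: (a) the quadrilateral $ABCD$ is an antiparallelogram (Darboux butterfly); (b) the points $G$ and $H$ lie on the axis $a$ of $\mathcal{P}$; (c) the diagonals $AC$ and $BD$ of the quadrilateral $ABCD$ are parallel, and both are perpendicular to the axis of the parabola; thus $ABDC$ is an isosceles trapezoid; (d) the midline of the isosceles trapezoid $ABDC$ is tangent to the parabola at its vertex.
   Context: A quadrilateral $ABCD$ (vertices in this cyclic order, possibly self-intersecting, with four distinct vertices) is inscribed in $\mathcal{D}$ if its vertices lie on $\mathcal{D}$, and circumscribed about $\mathcal{P}$ if the lines $AB,BC,CD,DA$ are tangent to $\mathcal{P}$. An antiparallelogram (Darboux butterfly) is a self-intersecting quadrilateral $ABCD$ with two pairs of congruent opposite sides, $|AB|=|CD|$ and $|BC|=|AD|$. The midline of the isosceles trapezoid $ABDC$ (with parallel sides $AC$ and $BD$, and legs $AB$ and $CD$) is the line through the midpoints of the legs. *)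

theory Defs
  imports "HOL-Analysis.Analysis"
begin

abbreviation line_through :: "real^2 \<Rightarrow> real^2 \<Rightarrow> (real^2) set" where
  "line_through X Y \<equiv> affine hull {X, Y}"

definition is_line :: "(real^2) set \<Rightarrow> bool" where
  "is_line L \<longleftrightarrow> affine L \<and> aff_dim L = 1"

definition perpendicular_lines :: "(real^2) set \<Rightarrow> (real^2) set \<Rightarrow> bool" where
  "perpendicular_lines L M \<longleftrightarrow>
     is_line L \<and> is_line M \<and> (\<forall>X\<in>L. \<forall>Y\<in>L. \<forall>U\<in>M. \<forall>V\<in>M. orthogonal (X - Y) (U - V))"

text \<open>A line does not count as parallel to itself.\<close>

definition parallel_lines :: "(real^2) set \<Rightarrow> (real^2) set \<Rightarrow> bool" where
  "parallel_lines L M \<longleftrightarrow> is_line L \<and> is_line M \<and> affine_parallel L M \<and> L \<noteq> M"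

text \<open>For \<open>X \<noteq> T\<close>, the quotient \<open>infdist X L / dist X T\<close> is the sine of the angle between \<open>L\<close> and
  the secant \<open>TX\<close>. So \<open>L\<close> is tangent to the curve \<open>S\<close> at \<open>T\<close> iff it is the limit of the secants
  \<open>TX\<close> as \<open>X\<close> tends to \<open>T\<close> along \<open>S\<close>; \<open>T islimpt S\<close> keeps the limit from being vacuous.\<close>

definition tangent_at :: "(real^2) set \<Rightarrow> real^2 \<Rightarrow> (real^2) set \<Rightarrow> bool" where
  "tangent_at S T L \<longleftrightarrow>
     is_line L \<and> T \<in> L \<and> T \<in> S \<and> T islimpt S \<and>
     ((\<lambda>X. infdist X L / dist X T) \<longlongrightarrow> 0) (at T within S)"

definition tangent_line :: "(real^2) set \<Rightarrow> (real^2) set \<Rightarrow> bool" where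
  "tangent_line S L \<longleftrightarrow> (\<exists>T. tangent_at S T L)"

text \<open>Focus \<open>F\<close> and directrix \<open>d\<close>; these describe a parabola when \<open>d\<close> is a line and \<open>F \<notin> d\<close>.\<close>

definition parabola :: "real^2 \<Rightarrow> (real^2) set \<Rightarrow> (real^2) set" where
  "parabola F d = {X. dist X F = infdist X d}"

text \<open>The line through the focus perpendicular to the directrix.\<close>

definition parabola_axis :: "real^2 \<Rightarrow> (real^2) set \<Rightarrow> (real^2) set" where
  "parabola_axis F d = {X. \<forall>U\<in>d. \<forall>V\<in>d. orthogonal (X - F) (U - V)}"

text \<open>Quadrilaterals are given by their vertices in cyclic order.\<close>

definition inscribed :: "real^2 \<Rightarrow> real^2 \<Rightarrow> real^2 \<Rightarrow> real^2 \<Rightarrow> (real^2) set \<Rightarrow> bool" where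
  "inscribed A B C D S \<longleftrightarrow> A \<in> S \<and> B \<in> S \<and> C \<in> S \<and> D \<in> S"

definition circumscribed :: "real^2 \<Rightarrow> real^2 \<Rightarrow> real^2 \<Rightarrow> real^2 \<Rightarrow> (real^2) set \<Rightarrow> bool" where
  "circumscribed A B C D S \<longleftrightarrow>
     tangent_line S (line_through A B) \<and> tangent_line S (line_through B C) \<and>
     tangent_line S (line_through C D) \<and> tangent_line S (line_through D A)"

definition self_intersecting :: "real^2 \<Rightarrow> real^2 \<Rightarrow> real^2 \<Rightarrow> real^2 \<Rightarrow> bool" where
  "self_intersecting A B C D \<longleftrightarrow>
     closed_segment A B \<inter> closed_segment C D \<noteq> {} \<or>
     closed_segment B C \<inter> closed_segment D A \<noteq> {}"

definition antiparallelogram :: "real^2 \<Rightarrow> real^2 \<Rightarrow> real^2 \<Rightarrow> real^2 \<Rightarrow> bool" where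
  "antiparallelogram A B C D \<longleftrightarrow>
     distinct [A, B, C, D] \<and> self_intersecting A B C D \<and>
     dist A B = dist C D \<and> dist B C = dist A D"

text \<open>Isosceles trapezoid \<open>KLMN\<close> with parallel sides \<open>LM\<close>, \<open>NK\<close> and legs \<open>KL\<close>, \<open>MN\<close>. As for
  all quadrilaterals here, self-intersection is not excluded: the legs may cross, in which case
  \<open>KMLN\<close> is the convex trapezoid on the same parallel sides.\<close>

definition isosceles_trapezoid :: "real^2 \<Rightarrow> real^2 \<Rightarrow> real^2 \<Rightarrow> real^2 \<Rightarrow> bool" where
  "isosceles_trapezoid K L M N \<longleftrightarrow>
     distinct [K, L, M, N] \<and>
     parallel_lines (line_through L M) (line_through N K) \<and>
     \<not> parallel_lines (line_through K L) (line_through M N) \<and>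
     dist K L = dist M N"

definition midline :: "real^2 \<Rightarrow> real^2 \<Rightarrow> real^2 \<Rightarrow> real^2 \<Rightarrow> (real^2) set" where
  "midline K L M N = line_through (midpoint K L) (midpoint M N)"

end

theory Submission
  imports Defs
begin

text \<open>The foot of the perpendicular from the focus to a tangent line of a parabola lies on the tangent
  at the vertex. For a chord of a circle centred at the focus this foot is the midpoint of the
  chord. So, measuring along the axis, the coordinates of adjacent vertices all have the same sum;
  hence \<open>A, C\<close> and \<open>B, D\<close> are two pairs of points symmetric in the axis.\<close>

section \<open>Lines of the plane as zero sets of affine functions\<close>

lemma infdist_hyperplane:
  fixes n X :: "'a::euclidean_space"
  assumes "n \<noteq> 0"
  shows "infdist X {Q. n \<bullet> Q = c} = \<bar>n \<bullet> X - c\<bar> / norm n"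
proof -
  let ?L = "{Q. n \<bullet> Q = c}"
  \<comment> \<open>\<open>Q\<close> is the foot of the perpendicular from \<open>X\<close>; it
    attains the distance, and Cauchy-Schwarz shows that no other point of the hyperplane is
    nearer.\<close>
  define Q where "Q = X - ((n \<bullet> X - c) / (norm n)\<^sup>2) *\<^sub>R n"
  have QL: "Q \<in> ?L"
    using assms by (simp add: Q_def inner_diff_right dot_square_norm)
  have dQ: "dist X Q = \<bar>n \<bullet> X - c\<bar> / norm n"
    using assms by (simp add: Q_def dist_norm power2_eq_square)
  have "\<bar>n \<bullet> X - c\<bar> / norm n \<le> dist X R" if "R \<in> ?L" for R
  proof -
    have "\<bar>n \<bullet> X - c\<bar> = \<bar>n \<bullet> (X - R)\<bar>"
      using that by (simp add: inner_diff_right)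
    also have "\<dots> \<le> norm n * dist X R"
      by (simp add: Cauchy_Schwarz_ineq2 dist_norm)
    finally show ?thesis
      using assms by (simp add: divide_le_eq mult.commute)
  qed
  then have "\<bar>n \<bullet> X - c\<bar> / norm n \<le> infdist X ?L"
    using QL by (auto simp: infdist_def intro: cINF_greatest)
  then show ?thesis
    using infdist_le[OF QL, of X] dQ by linarith
qed

lemma is_line_hyperplane:
  "is_line L \<longleftrightarrow> (\<exists>n c. n \<noteq> 0 \<and> L = {Q. n \<bullet> Q = c})"
proof
  assume L: "is_line L"
  then have "aff_dim L = DIM(real^2) - 1" "affine hull L = L"
    by (auto simp: is_line_def)
  then show "\<exists>n c. n \<noteq> 0 \<and> L = {Q. n \<bullet> Q = c}"
    using aff_dim_eq_hyperplane[of L] by metis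
next
  assume "\<exists>n c. n \<noteq> 0 \<and> L = {Q. n \<bullet> Q = c}"
  then show "is_line L"
    by (auto simp: is_line_def affine_hyperplane)
qed

lemma is_line_line_through: "is_line (line_through X Y)" if "X \<noteq> Y"
  using that by (simp add: is_line_def aff_dim_2)

lemma line_through_eq_hyperplane:
  fixes n X Y :: "real^2"
  assumes "n \<noteq> 0" "X \<noteq> Y" "n \<bullet> X = c" "n \<bullet> Y = c"
  shows "line_through X Y = {Q. n \<bullet> Q = c}"
proof -
  have "line_through X Y \<subseteq> {Q. n \<bullet> Q = c}"
    using assms by (intro hull_minimal) (auto simp: affine_hyperplane)
  moreover have "aff_dim (line_through X Y) = aff_dim {Q. n \<bullet> Q = c}"
    using assms by (simp add: aff_dim_2)
  ultimately have "affine hull (line_through X Y) = affine hull {Q. n \<bullet> Q = c}"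
    using aff_dim_eq_full_gen by blast
  then show ?thesis
    by (simp add: hull_hull affine_hyperplane)
qed

text \<open>If \<open>M\<close> is \<open>L\<close> translated by \<open>a\<close> and both contain
  \<open>Q\<close>, then \<open>a\<close> is a difference of two points of \<open>L\<close>. Hence
  \<open>M\<close> lies in \<open>L\<close>, and equal dimension forces \<open>L = M\<close>, which
  \<open>parallel_lines\<close> excludes.\<close>

lemma not_parallel_lines_if_meet:
  assumes "Q \<in> L" "Q \<in> M" shows "\<not> parallel_lines L M"
proof
  assume "parallel_lines L M"
  then have L: "affine L" "affine M" "affine_parallel L M" "aff_dim L = aff_dim M" "L \<noteq> M"
    by (auto simp: parallel_lines_def is_line_def)
  from L(3) obtain a where M: "M = (\<lambda>x. a + x) ` L"
    by (auto simp: affine_parallel_def)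
  with assms(2) obtain R where R: "R \<in> L" "Q = a + R"
    by blast
  have "a + x \<in> L" if "x \<in> L" for x
    using mem_affine_3_minus[OF L(1) that assms(1) R(1), of 1] R(2) by (simp add: add.commute)
  then have "M \<subseteq> L"
    using M by blast
  then show False
    using affine_dim_equal[of M L] L assms by auto
qed

section \<open>Orthonormal coordinates with origin \<open>F\<close>\<close>

locale planar_frame =
  fixes F e :: "real^2"
  assumes norm_e: "norm e = 1"
begin

text \<open>The unit vector \<open>e\<close> turned by a right angle, which completes it to an
  orthonormal basis.\<close>

definition f :: "real^2" where
  "f = vector [- e$2, e$1]"

definition pt :: "real \<Rightarrow> real \<Rightarrow> real^2" where
  "pt x y = F + x *\<^sub>R e + y *\<^sub>R f"

lemma frame_inner [simp]: "e \<bullet> e = 1" "f \<bullet> f = 1" "e \<bullet> f = 0" "f \<bullet> e = 0"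
proof -
  show ee: "e \<bullet> e = 1"
    by (simp add: dot_square_norm norm_e)
  show "f \<bullet> f = 1" "e \<bullet> f = 0" "f \<bullet> e = 0"
    using ee by (simp_all add: f_def inner_vec_def sum_2 algebra_simps)
qed

lemma pt_surj: obtains x y where "X = pt x y"
proof -
  let ?Z = "X - F"
  have ee: "e$1 * e$1 + e$2 * e$2 = 1"
    using frame_inner(1) by (simp add: inner_vec_def sum_2)
  \<comment> \<open>A polynomial identity valid for every \<open>e\<close>; the norm of
    \<open>e\<close> enters only when the factor on the right is replaced by 1.\<close>
  have "(e \<bullet> ?Z) *\<^sub>R e + (f \<bullet> ?Z) *\<^sub>R f = (e$1 * e$1 + e$2 * e$2) *\<^sub>R ?Z"
    by (simp add: vec_eq_iff forall_2 f_def inner_vec_def sum_2 algebra_simps)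
  then have "X = pt (e \<bullet> ?Z) (f \<bullet> ?Z)"
    by (simp add: ee pt_def algebra_simps)
  then show ?thesis
    by (rule that)
qed

lemma inner_e_pt: "e \<bullet> pt x y = e \<bullet> F + x"
  by (simp add: pt_def inner_add_right)

lemma inner_pt_diff:
  "(pt a b - pt c d) \<bullet> (pt a' b' - pt c' d') = (a - c) * (a' - c') + (b - d) * (b' - d')"
  by (simp add: pt_def algebra_simps inner_add_left inner_add_right inner_diff_left inner_diff_right)

lemma pt_eq_iff [simp]: "pt a b = pt c d \<longleftrightarrow> a = c \<and> b = d"
proof -
  have "pt a b = pt c d \<longleftrightarrow> (pt a b - pt c d) \<bullet> (pt a b - pt c d) = 0"
    by simp
  also have "\<dots> \<longleftrightarrow> a = c \<and> b = d"
    unfolding inner_pt_diff by (auto simp: sum_squares_eq_zero_iff)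
  finally show ?thesis .
qed

lemma dist_pt: "dist (pt a b) (pt c d) = sqrt ((a - c)\<^sup>2 + (b - d)\<^sup>2)"
  by (simp add: dist_norm norm_eq_sqrt_inner inner_pt_diff power2_eq_square)

lemma F_eq_pt: "F = pt 0 0"
  by (simp add: pt_def)

lemma pt_affine:
  assumes "u + v = 1"
  shows "u *\<^sub>R pt a b + v *\<^sub>R pt c d = pt (u * a + v * c) (u * b + v * d)"
proof -
  have "u *\<^sub>R F + v *\<^sub>R F = F"
    using assms by (metis scaleR_left_distrib scaleR_one)
  then show ?thesis
    by (simp add: pt_def algebra_simps)
qed

lemma midpoint_pt: "midpoint (pt a b) (pt c d) = pt ((a + c) / 2) ((b + d) / 2)"
  using pt_affine[of "1/2" "1/2" a b c d]
  by (simp add: midpoint_def scaleR_add_right add_divide_distrib)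

lemma pt_in_line_through:
  assumes "pt a b \<noteq> pt c d"
  shows "pt x y \<in> line_through (pt a b) (pt c d) \<longleftrightarrow> (d - b) * (x - a) = (c - a) * (y - b)"
proof -
  \<comment> \<open>Subtracting the origin gives the vector with coordinates \<open>d - b\<close>
    and \<open>a - c\<close>: the direction of the line turned by a right angle, hence a
    normal.\<close>
  define n where "n = pt (d - b) (a - c) - pt 0 0"
  have n: "n \<noteq> 0"
    using assms by (auto simp: n_def)
  have inner: "n \<bullet> (pt x y - pt a b) = (d - b) * (x - a) - (c - a) * (y - b)" for x y
    unfolding n_def inner_pt_diff by (simp add: algebra_simps)
  have *: "n \<bullet> pt x y = n \<bullet> pt a b \<longleftrightarrow> (d - b) * (x - a) = (c - a) * (y - b)" for x y
    using inner[of x y] unfolding inner_diff_right by linarith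
  have "line_through (pt a b) (pt c d) = {Q. n \<bullet> Q = n \<bullet> pt a b}"
    using n assms * by (intro line_through_eq_hyperplane) auto
  then show ?thesis
    by (simp add: *)
qed

lemma pt_in_closed_segment:
  "pt x y \<in> closed_segment (pt a b) (pt c d) \<longleftrightarrow>
     (\<exists>u. 0 \<le> u \<and> u \<le> 1 \<and> x = (1 - u) * a + u * c \<and> y = (1 - u) * b + u * d)"
  by (auto simp: closed_segment_def pt_affine)

lemma infdist_line_through:
  assumes "pt a b \<noteq> pt c d"
  shows "infdist (pt x y) (line_through (pt a b) (pt c d)) =
         \<bar>(d - b) * (x - a) - (c - a) * (y - b)\<bar> / dist (pt a b) (pt c d)"
proof -
  define n where "n = pt (d - b) (a - c) - pt 0 0"
  have n: "n \<noteq> 0"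
    using assms by (auto simp: n_def)
  have *: "n \<bullet> (pt x y - pt a b) = (d - b) * (x - a) - (c - a) * (y - b)" for x y
    unfolding n_def inner_pt_diff by (simp add: algebra_simps)
  have "n \<bullet> (pt c d - pt a b) = 0"
    unfolding * by simp
  then have "line_through (pt a b) (pt c d) = {Q. n \<bullet> Q = n \<bullet> pt a b}"
    using n assms by (intro line_through_eq_hyperplane) (auto simp: inner_diff_right)
  moreover have "norm n = dist (pt a b) (pt c d)"
    unfolding n_def dist_norm[symmetric] dist_pt by (simp add: power2_commute add.commute)
  ultimately show ?thesis
    using infdist_hyperplane[OF n, of "pt x y" "n \<bullet> pt a b"] *
    by (simp add: inner_diff_right)
qed

end

section \<open>The parabola with directrix \<open>x = - p\<close>, and its tangents\<close>

locale parabola_frame = planar_frame +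
  fixes d :: "(real^2) set" and p :: real
  assumes p_pos: "p > 0"
    and directrix: "d = {Q. e \<bullet> Q = e \<bullet> F - p}"
begin

lemma pt_in_directrix: "pt x y \<in> d \<longleftrightarrow> x = - p"
  by (auto simp: directrix inner_e_pt)

text \<open>Comparing the squares of the two distances cancels the square of \<open>x\<close>, so
  the parabola is a graph over the coordinate \<open>y\<close>.\<close>

lemma pt_in_parabola: "pt x y \<in> parabola F d \<longleftrightarrow> x = (y\<^sup>2 - p\<^sup>2) / (2 * p)"
proof -
  have "infdist (pt x y) d = \<bar>x + p\<bar>"
    using infdist_hyperplane[of e "pt x y" "e \<bullet> F - p"] norm_e
    by (fastforce simp: directrix inner_e_pt)
  moreover have "dist (pt x y) F = sqrt (x\<^sup>2 + y\<^sup>2)"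
    using dist_pt[of x y 0 0] by (simp add: F_eq_pt[symmetric])
  ultimately have "pt x y \<in> parabola F d \<longleftrightarrow> sqrt (x\<^sup>2 + y\<^sup>2) = sqrt ((x + p)\<^sup>2)"
    by (simp add: parabola_def)
  also have "\<dots> \<longleftrightarrow> y\<^sup>2 = p\<^sup>2 + 2 * p * x"
    by (simp add: power2_sum) argo
  finally show ?thesis
    using p_pos by (auto simp: field_simps)
qed

lemma pt_in_axis: "pt x y \<in> parabola_axis F d \<longleftrightarrow> y = 0"
proof
  assume "pt x y \<in> parabola_axis F d"
  moreover have "pt (- p) 1 \<in> d" "pt (- p) 0 \<in> d"
    by (simp_all add: pt_in_directrix)
  ultimately have "(pt x y - pt 0 0) \<bullet> (pt (- p) 1 - pt (- p) 0) = 0"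
    by (auto simp: parabola_axis_def orthogonal_def F_eq_pt[symmetric])
  then show "y = 0"
    unfolding inner_pt_diff by simp
next
  assume y: "y = 0"
  have "(pt x y - pt 0 0) \<bullet> (U - V) = 0" if "U \<in> d" "V \<in> d" for U V
  proof -
    obtain a b where U: "U = pt a b" by (rule pt_surj)
    obtain a' b' where V: "V = pt a' b'" by (rule pt_surj)
    show ?thesis
      using that unfolding U V inner_pt_diff by (simp add: pt_in_directrix y)
  qed
  then show "pt x y \<in> parabola_axis F d"
    by (simp add: parabola_axis_def orthogonal_def F_eq_pt[symmetric])
qed

text \<open>Parametrization of the parabola by \<open>y\<close>. It turns the limit in
  \<open>tangent_at\<close> into a limit in one real variable.\<close>

definition curve :: "real \<Rightarrow> real^2" where
  "curve y = pt ((y\<^sup>2 - p\<^sup>2) / (2 * p)) y"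

lemma filterlim_curve: "filterlim curve (at (curve y0) within parabola F d) (at y0)"
proof -
  have "(curve \<longlongrightarrow> curve y0) (at y0)"
    unfolding curve_def pt_def using p_pos by (auto intro!: tendsto_eq_intros)
  moreover have "\<forall>\<^sub>F y in at y0. curve y \<in> parabola F d \<and> curve y \<noteq> curve y0"
    by (auto simp: eventually_at_filter curve_def pt_in_parabola)
  ultimately show ?thesis
    by (simp add: filterlim_at)
qed

text \<open>The parametrization maps the nontrivial filter \<open>at y\<close> into the punctured
  neighbourhoods along the parabola, so these cannot form the trivial filter.\<close>

lemma curve_islimpt: "curve y islimpt parabola F d"
proof -
  have "at (curve y) within parabola F d \<noteq> bot"
    using filterlim_curve[of y] by (force simp: filterlim_def bot_unique filtermap_bot_iff)
  then show ?thesis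
    by (simp add: trivial_limit_within)
qed

text \<open>The conclusion says that the line has the direction of the derivative of
  \<open>curve\<close> at \<open>y0\<close>, since x changes there at the rate \<open>y0 / p\<close>
  with respect to y. Along the curve the quotient from \<open>tangent_at\<close> extends
  continuously to \<open>y0\<close>; the extension must vanish there, and so must its
  numerator.\<close>

lemma tangent_direction:
  assumes tan: "tangent_at (parabola F d) (curve y0) (line_through (pt a b) (pt a' b'))"
    and ne: "pt a b \<noteq> pt a' b'"
  shows "(b' - b) * y0 = p * (a' - a)"
proof -
  let ?L = "line_through (pt a b) (pt a' b')"
  let ?D = "dist (pt a b) (pt a' b')"
  \<comment> \<open>\<open>(y + y0) / (2 * p)\<close> is the slope of the secant, change of x over
    change of y. \<open>g\<close> is the quotient after cancelling
    \<open>\<bar>y - y0\<bar>\<close>, hence defined at \<open>y0\<close> too.\<close>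
  define g where "g y = \<bar>(b' - b) * ((y + y0) / (2 * p)) - (a' - a)\<bar> / ?D
                        / sqrt (((y + y0) / (2 * p))\<^sup>2 + 1)" for y
  have D: "?D > 0"
    using ne by simp
  have "(b' - b) * ((y0\<^sup>2 - p\<^sup>2) / (2 * p) - a) = (a' - a) * (y0 - b)"
    using tan pt_in_line_through[OF ne] by (simp add: tangent_at_def curve_def)
  \<comment> \<open>As the point of contact is on the line, \<open>a\<close> can be eliminated, and
    the numerator of the distance becomes a multiple of \<open>y - y0\<close>.\<close>
  then have T: "(b' - b) * a = (b' - b) * ((y0\<^sup>2 - p\<^sup>2) / (2 * p)) - (a' - a) * (y0 - b)"
    by (simp add: algebra_simps)
  have quot: "infdist (curve y) ?L / dist (curve y) (curve y0) = g y" if "y \<noteq> y0" for y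
  proof -
    let ?k = "(y + y0) / (2 * p)"
    have k: "(y\<^sup>2 - p\<^sup>2) / (2 * p) - (y0\<^sup>2 - p\<^sup>2) / (2 * p) = (y - y0) * ?k"
      using p_pos by (simp add: field_simps power2_eq_square)
    have "(b' - b) * ((y\<^sup>2 - p\<^sup>2) / (2 * p) - a) - (a' - a) * (y - b)
          = (b' - b) * ((y\<^sup>2 - p\<^sup>2) / (2 * p) - (y0\<^sup>2 - p\<^sup>2) / (2 * p)) - (a' - a) * (y - y0)"
      using T by (simp add: algebra_simps)
    also have "\<dots> = (y - y0) * ((b' - b) * ?k - (a' - a))"
      unfolding k by (simp only: algebra_simps)
    finally have 1: "infdist (curve y) ?L = \<bar>y - y0\<bar> * (\<bar>(b' - b) * ?k - (a' - a)\<bar> / ?D)"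
      unfolding curve_def infdist_line_through[OF ne] by (simp only: abs_mult times_divide_eq_right)
    have "dist (curve y) (curve y0) = sqrt ((y - y0)\<^sup>2 * (?k\<^sup>2 + 1))"
      unfolding curve_def dist_pt k by (simp only: power_mult_distrib distrib_left mult_1_right)
    then have 2: "dist (curve y) (curve y0) = \<bar>y - y0\<bar> * sqrt (?k\<^sup>2 + 1)"
      by (simp add: real_sqrt_mult)
    show ?thesis
      unfolding 1 2 g_def using that by simp
  qed
  have "((\<lambda>X. infdist X ?L / dist X (curve y0)) \<longlongrightarrow> 0) (at (curve y0) within parabola F d)"
    using tan by (simp add: tangent_at_def)
  then have "((\<lambda>y. infdist (curve y) ?L / dist (curve y) (curve y0)) \<longlongrightarrow> 0) (at y0)"
    by (rule filterlim_compose) (rule filterlim_curve)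
  then have "(g \<longlongrightarrow> 0) (at y0)"
    by (rule Lim_transform_eventually) (auto simp: eventually_at_filter quot)
  moreover have nz: "sqrt (((y + y0) / (2 * p))\<^sup>2 + 1) \<noteq> 0" for y
    by (simp add: add_nonneg_eq_0_iff)
  have "isCont g y0"
    unfolding g_def using nz[of y0] D p_pos by (intro continuous_intros) auto
  then have "(g \<longlongrightarrow> g y0) (at y0)"
    by (simp add: isCont_def)
  ultimately have "g y0 = 0"
    using tendsto_unique[of "at y0"] by simp
  then show ?thesis
    using D[THEN less_imp_neq] nz[of y0] p_pos by (simp add: g_def ne del: pt_eq_iff) (simp add: field_simps)
qed

text \<open>By \<open>eq\<close> both ends are equally far from the focus, so the conclusion places
  the midpoint of the chord on \<open>x = - p / 2\<close>, the tangent at the vertex. The proof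
  eliminates the point of contact by means of the slope \<open>k\<close>.\<close>

lemma tangent_chord_midpoint:
  assumes tan: "tangent_line (parabola F d) (line_through (pt a b) (pt a' b'))"
    and ne: "pt a b \<noteq> pt a' b'"
    and eq: "a\<^sup>2 + b\<^sup>2 = a'\<^sup>2 + b'\<^sup>2"
  shows "a + a' = - p"
proof -
  obtain T where T: "tangent_at (parabola F d) T (line_through (pt a b) (pt a' b'))"
    using tan by (auto simp: tangent_line_def)
  obtain x0 y0 where xy: "T = pt x0 y0"
    by (rule pt_surj)
  with T have x0: "x0 = (y0\<^sup>2 - p\<^sup>2) / (2 * p)"
    by (auto simp: tangent_at_def pt_in_parabola)
  then have "T = curve y0"
    by (simp add: xy curve_def)
  with T have dir: "(b' - b) * y0 = p * (a' - a)"
    using tangent_direction ne by blast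
  have on: "(b' - b) * (x0 - a) = (a' - a) * (y0 - b)"
    using T pt_in_line_through[OF ne] by (simp add: tangent_at_def xy)
  \<comment> \<open>No tangent is parallel to the axis: \<open>b' = b\<close> would give
    \<open>a' = a\<close> by \<open>dir\<close>.\<close>
  have bb: "b' - b \<noteq> 0"
    using dir ne p_pos by auto
  define k where "k = (a' - a) / (b' - b)"
  have a': "a' = a + k * (b' - b)"
    using bb by (simp add: k_def)
  have y0: "y0 = p * k"
    using dir bb by (simp add: k_def field_simps)
  have "(b' - b) * (x0 - a) = (b' - b) * (k * (y0 - b))"
    using on a' by (simp add: algebra_simps)
  then have xa: "x0 = a + k * (y0 - b)"
    using bb unfolding mult_cancel_left by simp
  have xk: "2 * x0 = p * (k\<^sup>2 - 1)"
    using p_pos by (simp add: x0 y0 power2_eq_square field_simps)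
  \<comment> \<open>The difference of the squared radii is the inner product of the chord with the
    sum of its ends. Its vanishing says that the line from the focus to the midpoint is
    perpendicular to the chord.\<close>
  have "(b' - b) * (k * (a + a') + (b + b')) = a'\<^sup>2 + b'\<^sup>2 - (a\<^sup>2 + b\<^sup>2)"
    by (simp add: a' power2_eq_square algebra_simps)
  then have s: "b + b' = - k * (a + a')"
    using bb eq by simp
  \<comment> \<open>The equation of the line at the point of contact, averaged over both ends so
    that only the sums of their coordinates occur.\<close>
  have "2 * x0 = (a + a') + 2 * k * y0 - k * (b + b')"
    using xa a' by (simp add: algebra_simps)
  then have "p * (k\<^sup>2 - 1) = (a + a') * (1 + k\<^sup>2) + 2 * p * k\<^sup>2"
    unfolding xk s y0 by (simp add: power2_eq_square algebra_simps)
  then have "(a + a' + p) * (1 + k\<^sup>2) = 0"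
    by (simp add: algebra_simps)
  moreover have "1 + k\<^sup>2 \<noteq> 0"
    by (simp add: add_nonneg_eq_0_iff)
  ultimately show ?thesis
    by simp
qed

lemma parabola_axis_Int: "parabola F d \<inter> parabola_axis F d = {pt (- p / 2) 0}"
proof -
  have "X \<in> parabola F d \<and> X \<in> parabola_axis F d \<longleftrightarrow> X = pt (- p / 2) 0" for X
  proof -
    obtain x y where X: "X = pt x y" by (rule pt_surj)
    show ?thesis
      using p_pos by (auto simp: X pt_in_parabola pt_in_axis power2_eq_square)
  qed
  then show ?thesis by auto
qed

text \<open>The distance from a point of the parabola to \<open>x = - p / 2\<close> is quadratic in
  its \<open>y\<close>, hence at most a constant times the squared distance to the vertex; the
  quotient in \<open>tangent_at\<close> is then bounded by a linear term.\<close>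

lemma tangent_at_vertex:
  assumes "b \<noteq> c"
  shows "tangent_at (parabola F d) (pt (- p / 2) 0) (line_through (pt (- p / 2) b) (pt (- p / 2) c))"
proof -
  let ?V = "pt (- p / 2) 0"
  let ?L = "line_through (pt (- p / 2) b) (pt (- p / 2) c)"
  have V: "?V = curve 0"
    using p_pos by (simp add: curve_def power2_eq_square)
  have ne: "pt (- p / 2) b \<noteq> pt (- p / 2) c"
    using assms by simp
  have le: "infdist X ?L / dist X ?V \<le> dist X ?V / (2 * p)" if "X \<in> parabola F d" for X
  proof -
    obtain x y where X: "X = pt x y" by (rule pt_surj)
    have x: "x + p / 2 = y\<^sup>2 / (2 * p)"
      using that p_pos by (simp add: X pt_in_parabola power2_eq_square field_simps)
    have "infdist X ?L = \<bar>x + p / 2\<bar>"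
      unfolding X infdist_line_through[OF ne] using assms
      by (simp add: dist_pt abs_mult abs_minus_commute[of b c])
    also have "\<dots> \<le> (dist X ?V)\<^sup>2 / (2 * p)"
      unfolding x using p_pos by (simp add: X dist_pt divide_right_mono)
    finally have "infdist X ?L / dist X ?V \<le> ((dist X ?V)\<^sup>2 / (2 * p)) / dist X ?V"
      by (rule divide_right_mono) simp
    \<comment> \<open>For \<open>X = ?V\<close> both sides are 0, as division by zero yields
      0.\<close>
    also have "\<dots> = dist X ?V / (2 * p)"
      by (simp add: power2_eq_square)
    finally show ?thesis .
  qed
  have "((\<lambda>X. dist X ?V / (2 * p)) \<longlongrightarrow> dist ?V ?V / (2 * p)) (at ?V within parabola F d)"
    using p_pos by (intro tendsto_intros) auto
  then have lim: "((\<lambda>X. dist X ?V / (2 * p)) \<longlongrightarrow> 0) (at ?V within parabola F d)"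
    by simp
  have "((\<lambda>X. infdist X ?L / dist X ?V) \<longlongrightarrow> 0) (at ?V within parabola F d)"
  proof (rule Lim_null_comparison[OF _ lim])
    show "\<forall>\<^sub>F X in at ?V within parabola F d. norm (infdist X ?L / dist X ?V) \<le> dist X ?V / (2 * p)"
      using le by (auto simp: eventually_at_filter infdist_nonneg)
  qed
  moreover have "?V islimpt parabola F d"
    unfolding V by (rule curve_islimpt)
  moreover have "?V \<in> ?L"
    unfolding pt_in_line_through[OF ne] by simp
  moreover have "?V \<in> parabola F d"
    using parabola_axis_Int by blast
  ultimately show ?thesis
    using is_line_line_through[OF ne] by (simp add: tangent_at_def)
qed

lemma is_line_axis: "is_line (parabola_axis F d)"
proof -
  have "parabola_axis F d = line_through (pt 0 0) (pt 1 0)"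
  proof (rule set_eqI)
    fix X
    obtain x y where "X = pt x y" by (rule pt_surj)
    then show "X \<in> parabola_axis F d \<longleftrightarrow> X \<in> line_through (pt 0 0) (pt 1 0)"
      by (simp add: pt_in_axis pt_in_line_through)
  qed
  then show ?thesis
    by (simp add: is_line_line_through)
qed

lemma perpendicular_axis:
  assumes "v \<noteq> v'"
  shows "perpendicular_lines (line_through (pt u v) (pt u v')) (parabola_axis F d)"
proof -
  have ne: "pt u v \<noteq> pt u v'"
    using assms by simp
  have "(X - Y) \<bullet> (U - V) = 0"
    if "X \<in> line_through (pt u v) (pt u v')" "Y \<in> line_through (pt u v) (pt u v')"
      "U \<in> parabola_axis F d" "V \<in> parabola_axis F d" for X Y U V
  proof -
    obtain x y where X: "X = pt x y" by (rule pt_surj)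
    obtain x' y' where Y: "Y = pt x' y'" by (rule pt_surj)
    obtain a b where U: "U = pt a b" by (rule pt_surj)
    obtain a' b' where V: "V = pt a' b'" by (rule pt_surj)
    show ?thesis
      using that assms unfolding X Y U V inner_pt_diff
      by (simp add: pt_in_line_through[OF ne] pt_in_axis)
  qed
  then show ?thesis
    using is_line_line_through[OF ne] is_line_axis by (simp add: perpendicular_lines_def orthogonal_def)
qed

end

section \<open>Lines and segments symmetric in the axis \<open>y = 0\<close>\<close>

context planar_frame
begin

lemma parallel_vertical_lines:
  assumes "v \<noteq> v'" "s \<noteq> s'" "u \<noteq> w"
  shows "parallel_lines (line_through (pt u v) (pt u v')) (line_through (pt w s) (pt w s'))"
    (is "parallel_lines ?L ?M")
proof -
  have neL: "pt u v \<noteq> pt u v'" and neM: "pt w s \<noteq> pt w s'"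
    using assms by simp_all
  have L: "pt x y \<in> ?L \<longleftrightarrow> x = u" and M: "pt x y \<in> ?M \<longleftrightarrow> x = w" for x y
    using assms by (simp_all add: pt_in_line_through)
  have shift: "(w - u) *\<^sub>R e + pt x y = pt (w - u + x) y" for x y
    by (simp add: pt_def algebra_simps)
  have "?M = (\<lambda>X. (w - u) *\<^sub>R e + X) ` ?L"
  proof (intro set_eqI iffI)
    fix X assume X: "X \<in> ?M"
    obtain x y where xy: "X = pt x y" by (rule pt_surj)
    have "X = (w - u) *\<^sub>R e + pt u y"
      using X by (simp add: shift xy M)
    then show "X \<in> (\<lambda>X. (w - u) *\<^sub>R e + X) ` ?L"
      using L by blast
  next
    fix X assume "X \<in> (\<lambda>X. (w - u) *\<^sub>R e + X) ` ?L"
    then obtain Y where Y: "X = (w - u) *\<^sub>R e + Y" "Y \<in> ?L" by blast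
    obtain x y where xy: "Y = pt x y" by (rule pt_surj)
    show "X \<in> ?M"
      using Y by (simp add: shift xy L M)
  qed
  then have "affine_parallel ?L ?M"
    unfolding affine_parallel_def by blast
  moreover have "?L \<noteq> ?M"
    using L[of u v] M[of u v] assms(3) by auto
  ultimately show ?thesis
    using is_line_line_through neL neM by (simp add: parallel_lines_def)
qed

text \<open>The two lines are mirror images in the axis and neither parallel nor perpendicular to
  it, so they meet exactly where each crosses the axis.\<close>

lemma symmetric_lines_Int:
  assumes "u \<noteq> w" "v \<noteq> s"
  shows "line_through (pt u v) (pt w s) \<inter> line_through (pt u (- v)) (pt w (- s))
         = {pt (u + (w - u) * v / (v - s)) 0}" (is "?L \<inter> ?M = {?H}")
proof -
  have "X \<in> ?L \<and> X \<in> ?M \<longleftrightarrow> X = ?H" for X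
  proof -
    obtain x y where X: "X = pt x y" by (rule pt_surj)
    have "X \<in> ?L \<and> X \<in> ?M \<longleftrightarrow>
        (s - v) * (x - u) = (w - u) * (y - v) \<and> (v - s) * (x - u) = (w - u) * (y + v)"
      using assms by (simp add: X pt_in_line_through)
    \<comment> \<open>Half the sum and half the difference of the two equations.\<close>
    also have "\<dots> \<longleftrightarrow> (w - u) * y = 0 \<and> (v - s) * (x - u) = (w - u) * v"
      by (simp only: left_diff_distrib right_diff_distrib distrib_left distrib_right) (intro iffI conjI; linarith)
    also have "\<dots> \<longleftrightarrow> y = 0 \<and> (v - s) * (x - u) = (w - u) * v"
      using assms by simp
    also have "\<dots> \<longleftrightarrow> X = ?H"
      using assms by (auto simp: X field_simps)
    finally show ?thesis .
  qed
  then show ?thesis by blast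
qed

lemma symmetric_segments_meet:
  assumes "v * s \<le> 0" "v \<noteq> s"
  shows "closed_segment (pt u v) (pt w s) \<inter> closed_segment (pt u (- v)) (pt w (- s)) \<noteq> {}"
proof -
  \<comment> \<open>The parameter at which the first segment crosses the axis; by symmetry the
    second crosses it there too.\<close>
  define t where "t = v / (v - s)"
  have t: "0 \<le> t" "t \<le> 1"
    using assms by (auto simp: t_def divide_simps mult_le_0_iff)
  have "(1 - t) * v + t * s = 0"
    using assms by (simp add: t_def field_simps)
  then have "pt ((1 - t) * u + t * w) 0 \<in> closed_segment (pt u v) (pt w s)"
    "pt ((1 - t) * u + t * w) 0 \<in> closed_segment (pt u (- v)) (pt w (- s))"
    using t by (auto simp: pt_in_closed_segment intro!: exI[of _ t])
  then show ?thesis by blast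
qed

text \<open>The segments lie strictly on opposite sides of the axis. Multiplying by \<open>v\<close>
  treats both signs at once: \<open>v * y\<close> is positive on the first segment and negative on
  the second.\<close>

lemma symmetric_segments_disjoint:
  assumes "v * s > 0"
  shows "closed_segment (pt u v) (pt w s) \<inter> closed_segment (pt u (- v)) (pt w (- s)) = {}"
proof (rule ccontr)
  assume "\<not> ?thesis"
  then obtain X where X: "X \<in> closed_segment (pt u v) (pt w s)"
    "X \<in> closed_segment (pt u (- v)) (pt w (- s))" by blast
  obtain x y where xy: "X = pt x y" by (rule pt_surj)
  have pos: "(1 - t) * v * v + t * (v * s) > 0" if "0 \<le> t" "t \<le> 1" for t
  proof (cases "t = 0")
    case True
    then show ?thesis using assms by (auto simp: zero_less_mult_iff)
  next
    case False
    then show ?thesis using that assms by (intro add_nonneg_pos) (auto simp: mult.assoc)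
  qed
  obtain t where t: "0 \<le> t" "t \<le> 1" "y = (1 - t) * v + t * s"
    using X xy by (auto simp: pt_in_closed_segment)
  obtain t' where t': "0 \<le> t'" "t' \<le> 1" "y = (1 - t') * (- v) + t' * (- s)"
    using X xy by (auto simp: pt_in_closed_segment)
  have "v * y = (1 - t) * v * v + t * (v * s)" "v * y = - ((1 - t') * v * v + t' * (v * s))"
    using t(3) t'(3) by algebra+
  then show False
    using pos[OF t(1,2)] pos[OF t'(1,2)] by linarith
qed

lemma vertical_segments_disjoint:
  assumes "u \<noteq> w"
  shows "closed_segment (pt u v) (pt u v') \<inter> closed_segment (pt w s) (pt w s') = {}"
proof (rule ccontr)
  assume "\<not> ?thesis"
  then obtain X where X: "X \<in> closed_segment (pt u v) (pt u v')"
    "X \<in> closed_segment (pt w s) (pt w s')" by blast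
  obtain x y where "X = pt x y" by (rule pt_surj)
  with X assms show False
    by (auto simp: pt_in_closed_segment algebra_simps)
qed

end

section \<open>The quadrilateral in coordinates\<close>

theorem theorem4p1:
  fixes F A B C D :: "real^2" and d :: "(real^2) set" and r :: real
  assumes "is_line d" and "F \<notin> d" and "r > 0"
    and "distinct [A, B, C, D]"
    and "inscribed A B C D (sphere F r)"
    and "circumscribed A B C D (parabola F d)"
  shows "antiparallelogram A B C D \<and>
         (\<exists>G H. line_through A D \<inter> line_through B C = {G} \<and>
                line_through A B \<inter> line_through C D = {H} \<and>
                G \<in> parabola_axis F d \<and> H \<in> parabola_axis F d) \<and>
         (parallel_lines (line_through A C) (line_through B D) \<and>
          perpendicular_lines (line_through A C) (parabola_axis F d) \<and>
          perpendicular_lines (line_through B D) (parabola_axis F d) \<and>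
          isosceles_trapezoid A B D C \<and>
          (\<not> self_intersecting A B D C \<or> \<not> self_intersecting A D B C)) \<and>
         (\<exists>V. parabola F d \<inter> parabola_axis F d = {V} \<and>
              tangent_at (parabola F d) V (midline A B D C))"
proof -
  obtain n c where n: "n \<noteq> 0" and d: "d = {Q. n \<bullet> Q = c}"
    using assms(1) is_line_hyperplane by blast
  \<comment> \<open>\<open>k\<close> scales \<open>n\<close> to a unit normal pointing from the
    directrix towards \<open>F\<close>, so that \<open>p\<close> is the positive distance between
    them.\<close>
  define k where "k = sgn (n \<bullet> F - c) / norm n"
  have nF: "n \<bullet> F - c \<noteq> 0"
    using assms(2) d by simp
  then have k: "k \<noteq> 0"
    using n by (simp add: k_def sgn_zero_iff)
  define e where "e = k *\<^sub>R n"
  define p where "p = k * (n \<bullet> F - c)"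
  interpret parabola_frame F e d p
  proof
    show "norm e = 1"
      using n nF by (simp add: e_def k_def abs_sgn_eq)
    show "p > 0"
      using n nF by (simp add: p_def k_def zero_less_mult_iff sgn_if)
    show "d = {Q. e \<bullet> Q = e \<bullet> F - p}"
      using k by (simp add: d e_def p_def right_diff_distrib)
  qed
  obtain u v where A: "A = pt u v" by (rule pt_surj)
  obtain w s where B: "B = pt w s" by (rule pt_surj)
  obtain u' v' where C: "C = pt u' v'" by (rule pt_surj)
  obtain w' s' where D: "D = pt w' s'" by (rule pt_surj)
  have sph: "pt x y \<in> sphere F r \<longleftrightarrow> x\<^sup>2 + y\<^sup>2 = r\<^sup>2" for x y
  proof -
    have "dist F (pt x y) = sqrt (x\<^sup>2 + y\<^sup>2)"
      using dist_pt[of 0 0 x y] by (simp add: F_eq_pt[symmetric])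
    then have "pt x y \<in> sphere F r \<longleftrightarrow> sqrt (x\<^sup>2 + y\<^sup>2) = sqrt (r\<^sup>2)"
      using assms(3) by simp
    then show ?thesis
      unfolding real_sqrt_eq_iff .
  qed
  have r: "u\<^sup>2 + v\<^sup>2 = r\<^sup>2" "w\<^sup>2 + s\<^sup>2 = r\<^sup>2" "u'\<^sup>2 + v'\<^sup>2 = r\<^sup>2" "w'\<^sup>2 + s'\<^sup>2 = r\<^sup>2"
    using assms(5) unfolding inscribed_def A B C D sph by blast+
  have tan: "tangent_line (parabola F d) (line_through A B)" "tangent_line (parabola F d) (line_through B C)"
    "tangent_line (parabola F d) (line_through C D)" "tangent_line (parabola F d) (line_through D A)"
    using assms(6) by (simp_all add: circumscribed_def)
  have ne: "A \<noteq> B" "B \<noteq> C" "C \<noteq> D" "D \<noteq> A"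
    using assms(4) by auto
  note mid = tangent_chord_midpoint[OF tan(1)[unfolded A B] ne(1)[unfolded A B]]
    tangent_chord_midpoint[OF tan(2)[unfolded B C] ne(2)[unfolded B C]]
    tangent_chord_midpoint[OF tan(3)[unfolded C D] ne(3)[unfolded C D]]
    tangent_chord_midpoint[OF tan(4)[unfolded D A] ne(4)[unfolded D A]]
  have "u + w = - p" "w + u' = - p" "u' + w' = - p" "w' + u = - p"
    using mid r by linarith+
  \<comment> \<open>Consecutive sums share the coordinate of a vertex, so opposite vertices have
    equal x. Being distinct points of the circle, they are then mirror images in the axis.\<close>
  then have uw: "u + w = - p" and u': "u' = u" and w': "w' = w"
    by simp_all
  have "v'\<^sup>2 = v\<^sup>2" "s'\<^sup>2 = s\<^sup>2"
    using r u' w' by simp_all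
  moreover have "v' \<noteq> v" "s' \<noteq> s"
    using assms(4) by (auto simp: A B C D u' w')
  ultimately have v': "v' = - v" and s': "s' = - s" and v0: "v \<noteq> 0" and s0: "s \<noteq> 0"
    by (auto simp: power2_eq_iff)
  \<comment> \<open>Otherwise \<open>B\<close> would have the same x as \<open>A\<close> and
    \<open>C\<close> and coincide with one of them.\<close>
  have uw_ne: "u \<noteq> w"
  proof
    assume "u = w"
    then have "s = v \<or> s = - v"
      using r by (simp add: power2_eq_iff[symmetric])
    then show False
      using assms(4) \<open>u = w\<close> by (auto simp: A B C D u' v')
  qed
  \<comment> \<open>Equality would give \<open>w = - u\<close>, against \<open>u + w = - p\<close>.
    Thus \<open>AB\<close> and \<open>AD\<close> are not parallel to the axis.\<close>
  have "v\<^sup>2 \<noteq> s\<^sup>2"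
  proof
    assume "v\<^sup>2 = s\<^sup>2"
    then have "u\<^sup>2 = w\<^sup>2" using r by simp
    then show False
      using uw uw_ne p_pos by (auto simp: power2_eq_iff)
  qed
  then have vs: "v \<noteq> s" "v \<noteq> - s"
    by auto
  note ABCD = A B C D u' w' v' s'
  have lenAB: "dist A B = dist C D" and lenBC: "dist B C = dist A D"
    by (simp_all add: ABCD dist_pt power2_commute power2_eq_square algebra_simps)
  \<comment> \<open>If \<open>A\<close> and \<open>B\<close> are on opposite sides of the axis,
    \<open>AB\<close> crosses \<open>CD\<close>; otherwise \<open>A\<close> and \<open>D\<close> are
    on opposite sides and \<open>AD\<close> crosses \<open>BC\<close>.\<close>
  have cross: "self_intersecting A B C D"
  proof (cases "v * s < 0")
    case True
    then show ?thesis
      using symmetric_segments_meet[of v s u w] vs by (simp add: ABCD self_intersecting_def)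
  next
    case False
    then show ?thesis
      using symmetric_segments_meet[of v "- s" u w] vs
      by (auto simp: ABCD self_intersecting_def closed_segment_commute Int_commute)
  qed
  obtain G where G: "line_through A D \<inter> line_through B C = {G}" "G \<in> parabola_axis F d"
    using symmetric_lines_Int[of u w v "- s"] uw_ne vs
    by (simp add: ABCD pt_in_axis insert_commute)
  obtain H where H: "line_through A B \<inter> line_through C D = {H}" "H \<in> parabola_axis F d"
    using symmetric_lines_Int[of u w v s] uw_ne vs
    by (simp add: ABCD pt_in_axis)
  have vv: "v \<noteq> - v" and ss: "s \<noteq> - s"
    using v0 s0 by auto
  have par: "parallel_lines (line_through A C) (line_through B D)"
    "parallel_lines (line_through B D) (line_through C A)"
    using parallel_vertical_lines vv ss uw_ne by (auto simp: ABCD)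
  have perp: "perpendicular_lines (line_through A C) (parabola_axis F d)"
    "perpendicular_lines (line_through B D) (parabola_axis F d)"
    using perpendicular_axis vv ss by (simp_all add: ABCD)
  have "\<not> parallel_lines (line_through A B) (line_through D C)"
    using H(1) not_parallel_lines_if_meet[of H] by (simp add: insert_commute set_eq_iff) blast
  then have trap: "isosceles_trapezoid A B D C"
    using assms(4) par(2) lenAB by (auto simp: isosceles_trapezoid_def dist_commute)
  \<comment> \<open>The same distinction decides which order of the vertices bounds a trapezoid
    without crossing legs: \<open>ABDC\<close> when \<open>A\<close> and \<open>B\<close> are on one
    side of the axis, \<open>ADBC\<close> otherwise.\<close>
  have simple: "\<not> self_intersecting A B D C \<or> \<not> self_intersecting A D B C"
  proof (cases "v * s > 0")
    case True
    then show ?thesis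
      using symmetric_segments_disjoint[of v s u w] vertical_segments_disjoint[OF uw_ne]
      by (auto simp: ABCD self_intersecting_def closed_segment_commute Int_commute)
  next
    case False
    then have "v * - s > 0"
      using v0 s0 by (simp add: zero_less_mult_iff mult_less_0_iff) linarith
    then show ?thesis
      using symmetric_segments_disjoint[of v "- s" u w] vertical_segments_disjoint[OF uw_ne]
      by (auto simp: ABCD self_intersecting_def closed_segment_commute Int_commute)
  qed
  \<comment> \<open>Since \<open>u + w = - p\<close>, both midpoints lie on the tangent at the
    vertex; they are distinct because \<open>v\<close> differs from \<open>- s\<close>.\<close>
  have "midline A B D C = line_through (pt (- p / 2) ((v + s) / 2)) (pt (- p / 2) (- (v + s) / 2))"
    using uw by (simp add: midline_def ABCD midpoint_pt add.commute)
  then have "tangent_at (parabola F d) (pt (- p / 2) 0) (midline A B D C)"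
    using tangent_at_vertex[of "(v + s) / 2" "- (v + s) / 2"] vs by (simp add: eq_neg_iff_add_eq_0)
  then show ?thesis
    using assms(4) cross lenAB lenBC G H par perp trap simple parabola_axis_Int
    unfolding antiparallelogram_def by blast
qed

end
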